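(* Let $0<R\le 1$, let $f$ be an analytic function without zeros in the disk $|z|<R$, and let $(\epsilon_n)_{n\ge1}$ be a sequence with each $\epsilon_n\in\{1,-1\}$. Then there exists a unique sequence $(\alpha_n)_{n\ge1}$ of complex numbers such that the product $f(0)\prod_{n=1}^{\infty}(1+\epsilon_n z^n)^{\alpha_n}$ converges compactly (i.e. uniformly on compact subsets) to $f$ on $|z|<R$. Moreover, writing $f(z)=f(0)\bigl(1+\sum_{n=1}^{\infty}b_nz^n\bigr)$ and $f'(z)/f(z)=\sum_{n=1}^{\infty}g_nz^{n-1}$, the following hold for every $n\ge1$: $$b_n=\sum \binom{\alpha_1}{k_1}\binom{\alpha_2}{k_2}\cdots\binom{\alpha_n}{k_n}\epsilon_1^{k_1}\epsilon_2^{k_2}\cdots\epsilon_n^{k_n},$$ where the sum extends over all non-negative integers $k_1,\dots,k_n$ with $k_1+2k_2+\dots+nk_n=n$; $$nb_n=g_n+\sum_{k=1}^{n-1}b_kg_{n-k};$$ $$-g_n=\sum_{d\mid n} d\,\alpha_d\,(-\epsilon_d)^{n/d-1}.$$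
   Context: For complex $\alpha$ and $|z|<1$, $(1+z)^\alpha$ denotes the binomial series $1+\sum_{n\ge1}\binom{\alpha}{n}z^n=e^{\alpha\,\mathrm{Log}(1+z)}$, where $\mathrm{Log}(1+z)=\sum_{n\ge1}(-1)^{n-1}z^n/n$ is the principal branch; $\binom{\alpha}{k}=\alpha(\alpha-1)\cdots(\alpha-k+1)/k!$. Infinite products are understood as limits of partial products.
   Formalization: In the last identity the exponent n/d−1 is corrected to n/d, i.e. −g_n = Σ_{d|n} d α_d (−ε_d)^{n/d}; as printed it fails for f(z)=1+z, R=1, ε_n=1 at n=1 (it would give −1=1). The two forms agree when all ε_d=−1. *)

theory Defs
  imports "HOL-Complex_Analysis.Complex_Analysis"
begin

text \<open>
  All sequences are indexed by the positive integers; their values at \<open>0\<close> are never used.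
  For \<open>norm z < 1\<close> and \<open>\<epsilon> n \<in> {1, - 1}\<close> the base \<open>1 + \<epsilon> n * z ^ n\<close> has positive real part, so
  \<open>powr\<close> (i.e. \<open>exp (\<alpha> n * Ln (1 + \<epsilon> n * z ^ n))\<close> with the principal logarithm) is the sum of the
  binomial series.
\<close>

definition partial_power_product ::
  "(nat \<Rightarrow> complex) \<Rightarrow> (nat \<Rightarrow> complex) \<Rightarrow> nat \<Rightarrow> complex \<Rightarrow> complex" where
  "partial_power_product \<epsilon> \<alpha> N z = (\<Prod>n = 1..N. (1 + \<epsilon> n * z ^ n) powr \<alpha> n)"

definition power_product_converges_compactly ::
  "real \<Rightarrow> (complex \<Rightarrow> complex) \<Rightarrow> (nat \<Rightarrow> complex) \<Rightarrow> (nat \<Rightarrow> complex) \<Rightarrow> bool" where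
  "power_product_converges_compactly R f \<epsilon> \<alpha> \<longleftrightarrow>
     (\<forall>K. compact K \<and> K \<subseteq> ball 0 R \<longrightarrow>
        uniform_limit K (\<lambda>N z. f 0 * partial_power_product \<epsilon> \<alpha> N z) f sequentially)"

definition weighted_exponents :: "nat \<Rightarrow> (nat \<Rightarrow> nat) set" where
  "weighted_exponents n = {k \<in> {1..n} \<rightarrow>\<^sub>E UNIV. (\<Sum>i = 1..n. i * k i) = n}"

end

theory Submission
  imports Defs
begin

text \<open>
  The factor \<open>(1 + \<epsilon> n * z ^ n) powr \<alpha> n\<close> only influences Taylor coefficients from degree \<open>n\<close> on, where
  it first adds \<open>\<alpha> n * \<epsilon> n\<close>. So the formal infinite product exists, determines all \<open>\<alpha> n\<close>, and is the
  Taylor series of any compact limit of the partial products up to the factor \<open>f 0\<close>; this gives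
  uniqueness and the coefficient formulas.

  For existence, the formula for \<open>g\<close> is solved recursively for \<open>\<alpha>\<close>. On \<open>norm z < R\<close> the logarithm
  \<open>\<Sum>n. \<alpha> n * Ln (1 + \<epsilon> n * z ^ n)\<close> then converges compactly, since \<open>\<alpha> n\<close> exceeds the size of \<open>g n\<close>
  by at most a polynomial factor and \<open>R \<le> 1\<close>. The limit of the product has the same logarithmic
  derivative as \<open>f\<close>, hence is proportional to it.
\<close>

subsection \<open>The formal power product\<close>

text \<open>The j-th power of the inner monomial lives in degree \<open>i * j\<close> alone, so each
  coefficient of the composition receives at most one term.\<close>

lemma fps_compose_monom_nth:
  fixes F :: "'a :: field fps"
  assumes "0 < i"
  shows "fps_nth (F oo (fps_const c * fps_X ^ i)) n =
           (if i dvd n then fps_nth F (n div i) * c ^ (n div i) else 0)"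
proof -
  have "fps_nth (F oo (fps_const c * fps_X ^ i)) n =
          (\<Sum>j = 0..n. fps_nth F j * (c ^ j * (if n = i * j then 1 else 0)))"
    by (simp add: fps_compose_nth power_mult_distrib fps_const_power flip: power_mult)
  also have "\<dots> = (\<Sum>j = 0..n. if j = n div i \<and> i dvd n then fps_nth F j * c ^ j else 0)"
    using assms by (intro sum.cong) auto
  also have "\<dots> = (if i dvd n then fps_nth F (n div i) * c ^ (n div i) else 0)"
    by (simp add: sum.delta')
  finally show ?thesis .
qed

section \<open>A single factor and its logarithmic derivative\<close>

definition power_factor_fps :: "complex \<Rightarrow> complex \<Rightarrow> nat \<Rightarrow> complex fps" where
  "power_factor_fps a e i = fps_binomial a oo (fps_const e * fps_X ^ i)"

text \<open>The Taylor series at 0 of \<open>i * a * e * z ^ (i - 1) / (1 + e * z ^ i)\<close>.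
  Expanding the geometric series, degree m with \<open>Suc m = i * q\<close> gets
  \<open>i * a * e * (- e) ^ (q - 1)\<close>, which is \<open>- (i * a * (- e) ^ q)\<close>.\<close>

definition log_deriv_factor_fps :: "complex \<Rightarrow> complex \<Rightarrow> nat \<Rightarrow> complex fps" where
  "log_deriv_factor_fps a e i =
     Abs_fps (\<lambda>m. if i dvd Suc m then - (of_nat i * a * (- e) ^ (Suc m div i)) else 0)"

lemma power_factor_fps_nth:
  "0 < i \<Longrightarrow> fps_nth (power_factor_fps a e i) n =
     (if i dvd n then (a gchoose (n div i)) * e ^ (n div i) else 0)"
  by (simp add: power_factor_fps_def fps_compose_monom_nth)

lemma has_fps_expansion_power_factor:
  assumes "0 < i"
  shows "(\<lambda>z. (1 + e * z ^ i) powr a) has_fps_expansion power_factor_fps a e i"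
proof -
  have "((\<lambda>x. (1 + x) powr a) \<circ> (\<lambda>z. e * z ^ i)) has_fps_expansion power_factor_fps a e i"
    unfolding power_factor_fps_def using assms
    by (intro has_fps_expansion_compose has_fps_expansion_binomial_complex
          has_fps_expansion_cmult_left has_fps_expansion_fps_X_power) auto
  then show ?thesis
    by (simp add: o_def)
qed

text \<open>The chain rule applied to the differential equation of the binomial series, whose
  derivative is a times the series divided by \<open>1 + fps_X\<close>.\<close>

lemma fps_deriv_power_factor:
  assumes "0 < i"
  shows "fps_deriv (power_factor_fps a e i) = power_factor_fps a e i * log_deriv_factor_fps a e i"
proof -
  define w :: "complex fps" where "w = fps_const e * fps_X ^ i"
  have w0: "fps_nth w 0 = 0"
    using assms by (simp add: w_def)
  have "fps_deriv (power_factor_fps a e i) =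
          (fps_binomial a * (fps_const a * inverse (1 + fps_X)) oo w) * fps_deriv w"
    unfolding power_factor_fps_def w_def [symmetric] fps_compose_deriv [OF w0] fps_binomial_deriv
    by (simp add: fps_divide_unit mult_ac)
  also have "\<dots> = power_factor_fps a e i * ((fps_const a * inverse (1 + fps_X) oo w) * fps_deriv w)"
    using w0 by (simp add: fps_compose_mult_distrib power_factor_fps_def w_def mult_ac)
  also have "(fps_const a * inverse (1 + fps_X) oo w) * fps_deriv w = log_deriv_factor_fps a e i"
  proof (rule fps_ext)
    fix m
    define G where "G = (fps_const a * inverse (1 + fps_X) oo w)"
    have G: "fps_nth G n = (if i dvd n then a * (- e) ^ (n div i) else 0)" for n
      unfolding G_def w_def fps_compose_monom_nth [OF assms] fps_inverse_fps_X_plus1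
      by (simp flip: power_mult_distrib)
    \<comment> \<open>Multiplying by \<open>fps_deriv w\<close> shifts degrees by
      \<open>i - 1\<close>, so coefficient m reads G at \<open>Suc m - i\<close>, which is divisible
      by i exactly when \<open>Suc m\<close> is.\<close>
    have "fps_deriv w = fps_const (e * of_nat i) * fps_X ^ (i - 1)"
      using assms by (intro fps_ext) (auto simp: w_def fps_mult_left_const_nth)
    then have "fps_nth (G * fps_deriv w) m =
                 (if i \<le> Suc m then fps_nth G (Suc m - i) * (e * of_nat i) else 0)"
      using assms by (simp add: fps_X_power_mult_right_nth not_le less_Suc_eq_le flip: mult.assoc) auto
    also have "\<dots> = fps_nth (log_deriv_factor_fps a e i) m"
    proof (cases "i dvd Suc m")
      case True
      then obtain q where q: "Suc m = i * q" by (elim dvdE)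
      with assms obtain p where "q = Suc p" by (cases q) auto
      with q have "Suc m = i + i * p" by simp
      then show ?thesis
        using assms by (simp add: G log_deriv_factor_fps_def mult_ac)
    next
      case False
      then have "\<not> i dvd Suc m - i" if "i \<le> Suc m"
        using that by (metis dvd_add_triv_right_iff le_add_diff_inverse2)
      with False show ?thesis
        by (simp add: G log_deriv_factor_fps_def)
    qed
    finally show "fps_nth ((fps_const a * inverse (1 + fps_X) oo w) * fps_deriv w) m =
                    fps_nth (log_deriv_factor_fps a e i) m"
      by (simp add: G_def)
  qed
  finally show ?thesis .
qed

section \<open>Partial products and their formal limit\<close>

definition partial_product_fps :: "(nat \<Rightarrow> complex) \<Rightarrow> (nat \<Rightarrow> complex) \<Rightarrow> nat \<Rightarrow> complex fps" where
  "partial_product_fps \<epsilon> \<alpha> N = (\<Prod>n = 1..N. power_factor_fps (\<alpha> n) (\<epsilon> n) n)"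

lemma partial_product_fps_Suc:
  "partial_product_fps \<epsilon> \<alpha> (Suc N) =
     partial_product_fps \<epsilon> \<alpha> N * power_factor_fps (\<alpha> (Suc N)) (\<epsilon> (Suc N)) (Suc N)"
  by (simp add: partial_product_fps_def)

lemma has_fps_expansion_partial_power_product:
  "partial_power_product \<epsilon> \<alpha> N has_fps_expansion partial_product_fps \<epsilon> \<alpha> N"
  unfolding partial_power_product_def [abs_def] partial_product_fps_def
  by (intro has_fps_expansion_prod has_fps_expansion_power_factor) auto

lemma fps_deriv_partial_product:
  "fps_deriv (partial_product_fps \<epsilon> \<alpha> N) =
     partial_product_fps \<epsilon> \<alpha> N * (\<Sum>n = 1..N. log_deriv_factor_fps (\<alpha> n) (\<epsilon> n) n)"
  by (induction N)
     (simp_all add: partial_product_fps_Suc fps_deriv_power_factor algebra_simps,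
      simp add: partial_product_fps_def)

text \<open>The new factor is 1 plus terms of degree at least \<open>Suc N\<close>, so it leaves all
  lower coefficients alone.\<close>

lemma partial_product_fps_Suc_nth_le:
  assumes "n \<le> N"
  shows "fps_nth (partial_product_fps \<epsilon> \<alpha> (Suc N)) n = fps_nth (partial_product_fps \<epsilon> \<alpha> N) n"
proof -
  have "fps_nth (partial_product_fps \<epsilon> \<alpha> (Suc N)) n =
    (\<Sum>j = 0..n. fps_nth (partial_product_fps \<epsilon> \<alpha> N) j * (if j = n then 1 else 0))"
    unfolding partial_product_fps_Suc fps_mult_nth
    using assms by (intro sum.cong refl) (auto simp: power_factor_fps_nth dest!: dvd_imp_le)
  then show ?thesis
    by (simp add: if_distrib [of "\<lambda>x. _ * x"] cong: if_cong)
qed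

lemma partial_product_fps_nth_stable:
  "n \<le> N \<Longrightarrow> fps_nth (partial_product_fps \<epsilon> \<alpha> N) n = fps_nth (partial_product_fps \<epsilon> \<alpha> n) n"
  by (induction N rule: dec_induct) (simp_all add: partial_product_fps_Suc_nth_le)

lemma partial_product_fps_nth_0: "fps_nth (partial_product_fps \<epsilon> \<alpha> N) 0 = 1"
  by (subst partial_product_fps_nth_stable) (simp_all add: partial_product_fps_def)

text \<open>In this degree the new factor contributes only through its constant term 1 and its first
  binomial term. The exponent thus enters linearly, which makes it recoverable from the
  product.\<close>

lemma partial_product_fps_Suc_nth_Suc:
  "fps_nth (partial_product_fps \<epsilon> \<alpha> (Suc N)) (Suc N) =
     fps_nth (partial_product_fps \<epsilon> \<alpha> N) (Suc N) + \<alpha> (Suc N) * \<epsilon> (Suc N)"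
proof -
  have *: "fps_nth (power_factor_fps (\<alpha> (Suc N)) (\<epsilon> (Suc N)) (Suc N)) (Suc N - j) =
    (if j = Suc N then 1 else 0) + (if j = 0 then \<alpha> (Suc N) * \<epsilon> (Suc N) else 0)"
    if "j \<le> Suc N" for j
    using that by (auto simp: power_factor_fps_nth dest!: dvd_imp_le)
  have "fps_nth (partial_product_fps \<epsilon> \<alpha> (Suc N)) (Suc N) =
    (\<Sum>j = 0..Suc N. fps_nth (partial_product_fps \<epsilon> \<alpha> N) j *
       ((if j = Suc N then 1 else 0) + (if j = 0 then \<alpha> (Suc N) * \<epsilon> (Suc N) else 0)))"
    unfolding partial_product_fps_Suc fps_mult_nth
    by (intro sum.cong refl) (use * in auto)
  also have "\<dots> = fps_nth (partial_product_fps \<epsilon> \<alpha> N) (Suc N) + \<alpha> (Suc N) * \<epsilon> (Suc N)"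
    by (simp add: distrib_left sum.distrib partial_product_fps_nth_0 if_distrib [of "\<lambda>x. _ * x"] cong: if_cong)
  finally show ?thesis .
qed

text \<open>Coefficient n is frozen from the n-th partial product on, so the diagonal already is the
  limit.\<close>

definition product_fps :: "(nat \<Rightarrow> complex) \<Rightarrow> (nat \<Rightarrow> complex) \<Rightarrow> complex fps" where
  "product_fps \<epsilon> \<alpha> = Abs_fps (\<lambda>n. fps_nth (partial_product_fps \<epsilon> \<alpha> n) n)"

lemma product_fps_nth_eq_partial:
  "n \<le> N \<Longrightarrow> fps_nth (product_fps \<epsilon> \<alpha>) n = fps_nth (partial_product_fps \<epsilon> \<alpha> N) n"
  unfolding product_fps_def fps_nth_Abs_fps by (rule partial_product_fps_nth_stable [symmetric])

lemma product_fps_nth_0: "fps_nth (product_fps \<epsilon> \<alpha>) 0 = 1"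
  by (simp add: product_fps_def partial_product_fps_nth_0)

lemma tendsto_product_fps: "partial_product_fps \<epsilon> \<alpha> \<longlonglongrightarrow> product_fps \<epsilon> \<alpha>"
  unfolding tendsto_fps_iff
proof
  fix n
  show "\<forall>\<^sub>F N in sequentially.
          fps_nth (partial_product_fps \<epsilon> \<alpha> N) n = fps_nth (product_fps \<epsilon> \<alpha>) n"
    using eventually_ge_at_top [of n]
    by eventually_elim (simp add: product_fps_nth_eq_partial)
qed

lemma fps_deriv_product_fps:
  "fps_deriv (product_fps \<epsilon> \<alpha>) = product_fps \<epsilon> \<alpha> *
     Abs_fps (\<lambda>m. - (\<Sum>d | d dvd Suc m. of_nat d * \<alpha> d * (- \<epsilon> d) ^ (Suc m div d)))"
  (is "_ = _ * ?G")
proof (rule fps_ext)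
  fix m
  \<comment> \<open>Coefficient m of the derivative involves coefficient \<open>Suc m\<close> of the
    product, and all divisors of \<open>Suc j\<close> with \<open>j \<le> m\<close> must index a
    factor.\<close>
  define N where "N = Suc m"
  note P = product_fps_nth_eq_partial [where N = N]
  have G: "fps_nth (\<Sum>n = 1..N. log_deriv_factor_fps (\<alpha> n) (\<epsilon> n) n) j = fps_nth ?G j" if "j \<le> m" for j
  proof -
    have "{d. d dvd Suc j} \<subseteq> {1..N}"
    proof
      fix d assume "d \<in> {d. d dvd Suc j}"
      then have d: "d dvd Suc j" by simp
      then have "d \<noteq> 0" by (intro notI) simp
      moreover have "d \<le> Suc j" using d by (rule dvd_imp_le) simp
      ultimately show "d \<in> {1..N}" using that by (simp add: N_def)
    qed
    then have "(\<Sum>n = 1..N. if n dvd Suc j then - (of_nat n * \<alpha> n * (- \<epsilon> n) ^ (Suc j div n)) else 0) =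
      (\<Sum>d | d dvd Suc j. - (of_nat d * \<alpha> d * (- \<epsilon> d) ^ (Suc j div d)))"
      by (intro sum.mono_neutral_cong_right) auto
    then show ?thesis
      by (simp add: fps_sum_nth log_deriv_factor_fps_def sum_negf)
  qed
  have "fps_nth (fps_deriv (product_fps \<epsilon> \<alpha>)) m = fps_nth (fps_deriv (partial_product_fps \<epsilon> \<alpha> N)) m"
    by (simp add: P N_def)
  also have "\<dots> = (\<Sum>j = 0..m. fps_nth (product_fps \<epsilon> \<alpha>) j * fps_nth ?G (m - j))"
    unfolding fps_deriv_partial_product fps_mult_nth
    by (intro sum.cong refl arg_cong2 [of _ _ _ _ "(*)"] P [symmetric] G) (auto simp: N_def)
  also have "\<dots> = fps_nth (product_fps \<epsilon> \<alpha> * ?G) m"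
    by (simp add: fps_mult_nth)
  finally show "fps_nth (fps_deriv (product_fps \<epsilon> \<alpha>)) m = fps_nth (product_fps \<epsilon> \<alpha> * ?G) m" .
qed

text \<open>Once all earlier exponents agree, equality of the degree-n coefficients reduces to
  \<open>\<alpha> n * \<epsilon> n = \<beta> n * \<epsilon> n\<close>.\<close>

lemma product_fps_inject:
  assumes "product_fps \<epsilon> \<alpha> = product_fps \<epsilon> \<beta>" and "\<And>n. 1 \<le> n \<Longrightarrow> \<epsilon> n \<noteq> 0" and "1 \<le> n"
  shows "\<alpha> n = \<beta> n"
  using \<open>1 \<le> n\<close>
proof (induction n rule: less_induct)
  case (less n)
  then obtain m where n: "n = Suc m" by (cases n) auto
  have "partial_product_fps \<epsilon> \<alpha> m = partial_product_fps \<epsilon> \<beta> m"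
    unfolding partial_product_fps_def using less.IH by (intro prod.cong) (auto simp: n)
  moreover have "fps_nth (partial_product_fps \<epsilon> \<alpha> n) n = fps_nth (partial_product_fps \<epsilon> \<beta> n) n"
    using arg_cong [OF assms(1), of "\<lambda>F. fps_nth F n"] by (simp add: product_fps_def)
  ultimately show ?case
    using assms(2) [of n] by (simp add: n partial_product_fps_Suc_nth_Suc)
qed

text \<open>Expanding the product means choosing from factor i a term of degree
  \<open>i * k i\<close>. The number m of factors and the degree n are kept apart because splitting
  off the last factor changes them independently.\<close>

lemma fps_prod_dilated_nth:
  fixes F :: "nat \<Rightarrow> 'a :: comm_ring_1 fps"
  assumes "\<And>i n. 0 < i \<Longrightarrow> fps_nth (F i) n = (if i dvd n then c i (n div i) else 0)"
  shows "fps_nth (\<Prod>i = 1..m. F i) n =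
           (\<Sum>k | k \<in> {1..m} \<rightarrow>\<^sub>E UNIV \<and> (\<Sum>i = 1..m. i * k i) = n. \<Prod>i = 1..m. c i (k i))"
proof (induction m arbitrary: n)
  case 0
  \<comment> \<open>Over the empty index set the only extensional function is constantly
    \<open>undefined\<close>; it accounts for the constant term of the empty product.\<close>
  have "{k. k \<in> {1..0::nat} \<rightarrow>\<^sub>E (UNIV :: nat set) \<and> (\<Sum>i = 1..0::nat. i * k i) = n} =
          (if n = 0 then {\<lambda>_. undefined} else {})"
    by auto
  then show ?case
    by simp
next
  case (Suc m)
  define W where "W = (\<lambda>m n. {k :: nat \<Rightarrow> nat. k \<in> {1..m} \<rightarrow>\<^sub>E UNIV \<and> (\<Sum>i = 1..m. i * k i) = n})"
  have fin: "finite (W m n)" for m n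
  proof (rule finite_subset)
    show "W m n \<subseteq> {1..m} \<rightarrow>\<^sub>E {..n}"
    proof
      fix k assume k: "k \<in> W m n"
      have "k i \<le> n" if "i \<in> {1..m}" for i
      proof -
        have "k i \<le> i * k i" using that by auto
        also have "\<dots> \<le> (\<Sum>i = 1..m. i * k i)" using that by (intro member_le_sum) auto
        finally show ?thesis using k by (simp add: W_def)
      qed
      then show "k \<in> {1..m} \<rightarrow>\<^sub>E {..n}"
        using k by (auto simp: W_def PiE_def Pi_def)
    qed
  qed (simp add: finite_PiE)
  define Q where "Q = {q. Suc m * q \<le> n}"
  have Q: "finite Q"
    by (rule finite_subset [of _ "{..n}"]) (auto simp: Q_def)
  have "fps_nth (\<Prod>i = 1..Suc m. F i) n =
          (\<Sum>j = 0..n. fps_nth (F (Suc m)) j * fps_nth (\<Prod>i = 1..m. F i) (n - j))"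
    by (simp add: mult.commute [of _ "F (Suc m)"] fps_mult_nth)
  \<comment> \<open>Only multiples \<open>j = Suc m * q\<close> survive in the last factor; the sum
    is re-indexed by q.\<close>
  also have "\<dots> = (\<Sum>q\<in>Q. c (Suc m) q * fps_nth (\<Prod>i = 1..m. F i) (n - Suc m * q))"
  proof (rule sum.mono_neutral_cong_right [THEN trans])
    show "{j. j \<le> n \<and> Suc m dvd j} \<subseteq> {0..n}" by auto
    show "(\<Sum>j | j \<le> n \<and> Suc m dvd j. c (Suc m) (j div Suc m) * fps_nth (\<Prod>i = 1..m. F i) (n - j)) =
       (\<Sum>q\<in>Q. c (Suc m) q * fps_nth (\<Prod>i = 1..m. F i) (n - Suc m * q))"
      by (rule sum.reindex_bij_witness [of _ "\<lambda>q. Suc m * q" "\<lambda>j. j div Suc m"])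
         (auto simp: Q_def simp del: mult_Suc)
  qed (auto simp: assms)
  also have "\<dots> = (\<Sum>q\<in>Q. \<Sum>k\<in>W m (n - Suc m * q). c (Suc m) q * (\<Prod>i = 1..m. c i (k i)))"
    by (simp add: Suc.IH W_def sum_distrib_left del: One_nat_def mult_Suc)
  also have "\<dots> = (\<Sum>(q, k)\<in>(SIGMA q:Q. W m (n - Suc m * q)). c (Suc m) q * (\<Prod>i = 1..m. c i (k i)))"
    using Q fin by (intro sum.Sigma) auto
  also have "\<dots> = (\<Sum>k\<in>W (Suc m) n. \<Prod>i = 1..Suc m. c i (k i))"
  \<comment> \<open>A tuple on \<open>{1..Suc m}\<close> corresponds to its last entry q and its
    restriction to \<open>{1..m}\<close>; \<open>restrict\<close> resets the value at
    \<open>Suc m\<close> to \<open>undefined\<close>, as extensionality demands.\<close>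
  proof (rule sum.reindex_bij_witness [of _ "\<lambda>k. (k (Suc m), restrict k {1..m})" "\<lambda>(q, k). k(Suc m := q)"])
    fix x assume "x \<in> (SIGMA q:Q. W m (n - Suc m * q))"
    then obtain q k where x: "x = (q, k)" and q: "Suc m * q \<le> n" and k: "k \<in> {1..m} \<rightarrow>\<^sub>E UNIV"
      and sum: "(\<Sum>i = 1..m. i * k i) = n - Suc m * q"
      by (auto simp: Q_def W_def)
    have upd: "(\<Sum>i = 1..m. i * (k(Suc m := q)) i) = (\<Sum>i = 1..m. i * k i)"
      "(\<Prod>i = 1..m. c i ((k(Suc m := q)) i)) = (\<Prod>i = 1..m. c i (k i))"
      by (auto intro!: sum.cong prod.cong)
    have "restrict (k(Suc m := q)) {1..m} = k"
      using k by (auto simp: restrict_def fun_eq_iff PiE_def extensional_def)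
    then show "(((\<lambda>(q, k). k(Suc m := q)) x) (Suc m), restrict ((\<lambda>(q, k). k(Suc m := q)) x) {1..m}) = x"
      by (simp add: x)
    have "k(Suc m := q) \<in> {1..Suc m} \<rightarrow>\<^sub>E UNIV"
      using k by (auto simp: PiE_def extensional_def)
    then show "(\<lambda>(q, k). k(Suc m := q)) x \<in> W (Suc m) n"
      using q sum upd(1) by (simp add: x W_def)
    show "(\<Prod>i = 1..Suc m. c i (((\<lambda>(q, k). k(Suc m := q)) x) i)) =
            (case x of (q, k) \<Rightarrow> c (Suc m) q * (\<Prod>i = 1..m. c i (k i)))"
      using upd(2) by (simp add: x mult.commute)
  next
    fix k assume k: "k \<in> W (Suc m) n"
    then show "(\<lambda>(q, k). k(Suc m := q)) (k (Suc m), restrict k {1..m}) = k"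
      by (auto simp: W_def fun_eq_iff PiE_def extensional_def)
    have "(\<Sum>i = 1..m. i * k i) + Suc m * k (Suc m) = n"
      using k by (simp add: W_def)
    then show "(k (Suc m), restrict k {1..m}) \<in> (SIGMA q:Q. W m (n - Suc m * q))"
      by (auto simp: Q_def W_def)
  qed
  finally show ?case
    by (simp add: W_def)
qed

lemma product_fps_nth:
  "fps_nth (product_fps \<epsilon> \<alpha>) n =
     (\<Sum>k\<in>weighted_exponents n. (\<Prod>i = 1..n. \<alpha> i gchoose k i) * (\<Prod>i = 1..n. \<epsilon> i ^ k i))"
proof -
  have "fps_nth (power_factor_fps (\<alpha> i) (\<epsilon> i) i) n =
          (if i dvd n then (\<alpha> i gchoose (n div i)) * \<epsilon> i ^ (n div i) else 0)" if "0 < i" for i n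
    using that by (rule power_factor_fps_nth)
  from fps_prod_dilated_nth [OF this, of n n] show ?thesis
    by (simp only: product_fps_def partial_product_fps_def fps_nth_Abs_fps weighted_exponents_def
          prod.distrib)
qed

subsection \<open>Compact limits of power products\<close>

text \<open>Keeps the bases off the branch cut of \<open>Ln\<close>, so that the factors and their
  logarithms are holomorphic.\<close>

lemma one_plus_sign_power_not_nonpos:
  fixes z e :: complex
  assumes "norm z < 1" "e \<in> {1, - 1}" "1 \<le> n"
  shows "1 + e * z ^ n \<notin> \<real>\<^sub>\<le>\<^sub>0"
proof
  assume "1 + e * z ^ n \<in> \<real>\<^sub>\<le>\<^sub>0"
  then have "Re (1 + e * z ^ n) \<le> 0"
    by (simp add: complex_nonpos_Reals_iff)
  moreover have "norm (e * z ^ n) < 1"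
    using assms by (auto simp: norm_mult norm_power power_less_one_iff)
  then have "\<bar>Re (e * z ^ n)\<bar> < 1"
    using abs_Re_le_cmod le_less_trans by blast
  ultimately show False
    by simp
qed

lemma holomorphic_on_partial_power_product:
  assumes "R \<le> 1" "\<And>n. 1 \<le> n \<Longrightarrow> \<epsilon> n \<in> {1, - 1}"
  shows "partial_power_product \<epsilon> \<alpha> N holomorphic_on ball 0 R"
  unfolding partial_power_product_def [abs_def]
proof (intro holomorphic_intros)
  fix n z assume "n \<in> {1..N}" "z \<in> ball (0 :: complex) R"
  then show "1 + \<epsilon> n * z ^ n \<notin> \<real>\<^sub>\<le>\<^sub>0"
    using assms by (intro one_plus_sign_power_not_nonpos) auto
qed

text \<open>Locally uniform limits of holomorphic functions pass to Taylor coefficients, and those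
  of the partial products are eventually constant.\<close>

lemma fps_expansion_of_convergent_power_product:
  assumes "0 < R" "R \<le> 1" "\<And>n. 1 \<le> n \<Longrightarrow> \<epsilon> n \<in> {1, - 1}"
    and "power_product_converges_compactly R f \<epsilon> \<alpha>" and "f has_fps_expansion F"
  shows "F = fps_const (f 0) * product_fps \<epsilon> \<alpha>"
proof (rule uniform_limit_imp_fps_expansion_eq)
  show "(\<lambda>N. fps_const (f 0) * partial_product_fps \<epsilon> \<alpha> N) \<longlonglongrightarrow> fps_const (f 0) * product_fps \<epsilon> \<alpha>"
    unfolding tendsto_fps_iff
  proof
    fix n
    have "\<forall>\<^sub>F N in sequentially.
            fps_nth (partial_product_fps \<epsilon> \<alpha> N) n = fps_nth (product_fps \<epsilon> \<alpha>) n"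
      using tendsto_product_fps unfolding tendsto_fps_iff by blast
    then show "\<forall>\<^sub>F N in sequentially. fps_nth (fps_const (f 0) * partial_product_fps \<epsilon> \<alpha> N) n =
                 fps_nth (fps_const (f 0) * product_fps \<epsilon> \<alpha>) n"
      by eventually_elim simp
  qed
  have "uniform_limit (cball 0 (R / 2)) (\<lambda>N z. f 0 * partial_power_product \<epsilon> \<alpha> N z) f sequentially"
    using assms(1,4) unfolding power_product_converges_compactly_def by (auto simp: subset_iff)
  then show "uniform_limit (ball 0 (R / 2)) (\<lambda>N z. f 0 * partial_power_product \<epsilon> \<alpha> N z) f sequentially"
    by (rule uniform_limit_on_subset) auto
  show "\<forall>\<^sub>F N in sequentially. (\<lambda>z. f 0 * partial_power_product \<epsilon> \<alpha> N z) has_fps_expansion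
          fps_const (f 0) * partial_product_fps \<epsilon> \<alpha> N"
    by (intro always_eventually allI has_fps_expansion_cmult_left
          has_fps_expansion_partial_power_product)
  have "partial_power_product \<epsilon> \<alpha> N holomorphic_on ball 0 (R / 2)" for N
    using assms by (intro holomorphic_on_partial_power_product) auto
  then show "\<forall>\<^sub>F N in sequentially.
      (\<lambda>z. f 0 * partial_power_product \<epsilon> \<alpha> N z) holomorphic_on ball 0 (R / 2)"
    by (intro always_eventually allI holomorphic_intros)
qed (use assms in auto)

text \<open>The Taylor series of f is a constant multiple of the formal product, so the formal
  logarithmic derivative carries over. This serves the existence proof as well as the formula for
  g.\<close>

lemma log_deriv_of_convergent_power_product:
  assumes "0 < R" "R \<le> 1" "\<And>n. 1 \<le> n \<Longrightarrow> \<epsilon> n \<in> {1, - 1}"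
    and "power_product_converges_compactly R f \<epsilon> \<alpha>" and F: "f has_fps_expansion F" and "f 0 \<noteq> 0"
  shows "(\<lambda>z. deriv f z / f z) has_fps_expansion
     Abs_fps (\<lambda>m. - (\<Sum>d | d dvd Suc m. of_nat d * \<alpha> d * (- \<epsilon> d) ^ (Suc m div d)))"
  (is "_ has_fps_expansion ?G")
proof -
  have FP: "F = fps_const (f 0) * product_fps \<epsilon> \<alpha>"
    using assms(1-5) by (rule fps_expansion_of_convergent_power_product)
  have F0: "fps_nth F 0 \<noteq> 0"
    using \<open>f 0 \<noteq> 0\<close> by (simp add: FP product_fps_nth_0)
  have "fps_deriv F = F * ?G"
    by (simp add: FP fps_deriv_product_fps mult.assoc)
  moreover have "F \<noteq> 0"
    using F0 by auto
  ultimately have "fps_deriv F / F = ?G"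
    by simp
  moreover have "(\<lambda>z. deriv f z / f z) has_fps_expansion fps_deriv F / F"
    using F F0 by (intro has_fps_expansion_divide' has_fps_expansion_deriv)
  ultimately show ?thesis
    by simp
qed

subsection \<open>Growth of the exponents\<close>

text \<open>Telescoping: each term is \<open>1 / (m - 1) - 1 / m\<close>.\<close>

lemma sum_inverse_consecutive: "1 \<le> n \<Longrightarrow> (\<Sum>m = 2..n. 1 / (real m * (real m - 1))) = 1 - 1 / real n"
proof (induction n rule: dec_induct)
  case (step n)
  have "(\<Sum>m = 2..Suc n. 1 / (real m * (real m - 1))) = 1 - 1 / real n + 1 / (real (Suc n) * real n)"
    using step by simp
  also have "\<dots> = 1 - 1 / real (Suc n)"
    using step.hyps by (simp add: divide_simps del: of_nat_Suc) (simp add: algebra_simps)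
  finally show ?case .
qed simp

text \<open>Replacing d by its cofactor \<open>m = n div d \<ge> 2\<close> gives a sum of
  \<open>n^2 / m^2\<close>; comparison with the telescoping sum bounds it by
  \<open>n^2 - n\<close>.\<close>

lemma sum_proper_divisor_squares_le:
  assumes "1 \<le> n"
  shows "(\<Sum>d | d dvd n \<and> d < n. (real d)\<^sup>2) \<le> (real n)\<^sup>2 - 1"
proof -
  have "(\<Sum>d | d dvd n \<and> d < n. (real d)\<^sup>2) = (\<Sum>m | m dvd n \<and> 1 < m. (real n / real m)\<^sup>2)"
    using assms
    by (intro sum.reindex_bij_witness [of _ "\<lambda>m. n div m" "\<lambda>d. n div d"])
       (auto simp: real_of_nat_div elim!: dvdE)
  also have "\<dots> \<le> (\<Sum>m = 2..n. (real n / real m)\<^sup>2)"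
    using assms by (intro sum_mono2) (auto dest: dvd_imp_le)
  also have "\<dots> \<le> (\<Sum>m = 2..n. (real n)\<^sup>2 * (1 / (real m * (real m - 1))))"
    by (intro sum_mono) (auto simp: power_divide power2_eq_square intro!: divide_left_mono mult_left_mono)
  also have "\<dots> = (real n)\<^sup>2 * (1 - 1 / real n)"
    using assms by (simp only: sum_inverse_consecutive flip: sum_distrib_left)
  also have "\<dots> = (real n)\<^sup>2 - real n"
    using assms by (simp add: field_simps power2_eq_square)
  finally show ?thesis
    using assms by simp
qed

text \<open>
  Solves \<open>- g n = (\<Sum>d | d dvd n. d * \<alpha> d * (- \<epsilon> d) ^ (n div d))\<close> for the term \<open>d = n\<close>, using
  \<open>\<epsilon> n * \<epsilon> n = 1\<close>.
\<close>
fun exponent_of_log_deriv :: "(nat \<Rightarrow> complex) \<Rightarrow> (nat \<Rightarrow> complex) \<Rightarrow> nat \<Rightarrow> complex" where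
  "exponent_of_log_deriv \<epsilon> g n =
     \<epsilon> n * (g n + (\<Sum>d | d dvd n \<and> d < n.
       of_nat d * exponent_of_log_deriv \<epsilon> g d * (- \<epsilon> d) ^ (n div d))) / of_nat n"

declare exponent_of_log_deriv.simps [simp del]

lemma exponent_of_log_deriv_self:
  assumes "\<epsilon> n \<in> {1, - 1}" "1 \<le> n"
  shows "of_nat n * exponent_of_log_deriv \<epsilon> g n * \<epsilon> n =
     g n + (\<Sum>d | d dvd n \<and> d < n. of_nat d * exponent_of_log_deriv \<epsilon> g d * (- \<epsilon> d) ^ (n div d))"
  using assms by (subst exponent_of_log_deriv.simps) auto

lemma finite_proper_divisors: "finite {d. d dvd n \<and> d < (n :: nat)}"
  by (rule finite_subset [of _ "{..<n}"]) auto

text \<open>The term \<open>d = n\<close> is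
  \<open>- (of_nat n * \<alpha> n * \<epsilon> n)\<close>; by the recursion this is
  \<open>- g n\<close> minus the sum over the proper divisors.\<close>

lemma exponent_of_log_deriv_divisor_sum:
  assumes "\<epsilon> n \<in> {1, - 1}" "1 \<le> n"
  shows "(\<Sum>d | d dvd n. of_nat d * exponent_of_log_deriv \<epsilon> g d * (- \<epsilon> d) ^ (n div d)) = - g n"
proof -
  have "{d. d dvd n} = insert n {d. d dvd n \<and> d < n}"
    using assms by (auto dest: dvd_imp_le)
  then show ?thesis
    using assms exponent_of_log_deriv_self [of \<epsilon> n g, OF assms] finite_proper_divisors [of n]
    by simp
qed

text \<open>
  The factor \<open>n\<^sup>2\<close> makes the induction close, because the squares of the proper divisors of \<open>n\<close>
  sum to at most \<open>n\<^sup>2 - 1\<close>; being polynomial, it costs nothing in the radius of convergence.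
\<close>
lemma exponent_of_log_deriv_bound:
  assumes \<epsilon>: "\<And>n. 1 \<le> n \<Longrightarrow> \<epsilon> n \<in> {1, - 1}"
    and r: "0 \<le> r" "r \<le> 1" and g: "\<And>n. 1 \<le> n \<Longrightarrow> norm (g n) * r ^ n \<le> M"
    and "1 \<le> n"
  shows "of_nat n * norm (exponent_of_log_deriv \<epsilon> g n) * r ^ n \<le> M * (real n)\<^sup>2"
  using \<open>1 \<le> n\<close>
proof (induction n rule: less_induct)
  case (less n)
  let ?\<alpha> = "exponent_of_log_deriv \<epsilon> g"
  let ?D = "{d. d dvd n \<and> d < n}"
  have norm_\<epsilon>: "norm (\<epsilon> k) = 1" if "1 \<le> k" for k
    using \<epsilon> [OF that] by auto
  have D: "1 \<le> d" if "d \<in> ?D" for d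
    using that less.prems by (cases d) auto
  have "M \<ge> 0"
    using g [of 1] r by (intro order_trans [OF _ g [of 1]]) auto
  have "of_nat n * norm (?\<alpha> n) = norm (of_nat n * ?\<alpha> n * \<epsilon> n)"
    using less.prems by (simp add: norm_mult norm_\<epsilon>)
  also have "\<dots> \<le> norm (g n) + (\<Sum>d\<in>?D. norm (of_nat d * ?\<alpha> d * (- \<epsilon> d) ^ (n div d)))"
    unfolding exponent_of_log_deriv_self [of \<epsilon> n g, OF \<epsilon> [OF less.prems] less.prems]
    by (intro order_trans [OF norm_triangle_ineq] add_mono sum_norm_le) auto
  also have "\<dots> = norm (g n) + (\<Sum>d\<in>?D. of_nat d * norm (?\<alpha> d))"
    using D by (intro arg_cong2 [of _ _ _ _ "(+)"] sum.cong)
      (auto simp: norm_mult norm_power norm_\<epsilon>)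
  finally have "of_nat n * norm (?\<alpha> n) * r ^ n \<le>
      (norm (g n) + (\<Sum>d\<in>?D. of_nat d * norm (?\<alpha> d))) * r ^ n"
    using r by (intro mult_right_mono) auto
  also have "\<dots> = norm (g n) * r ^ n + (\<Sum>d\<in>?D. of_nat d * norm (?\<alpha> d) * r ^ n)"
    by (simp add: distrib_right sum_distrib_right)
  also have "\<dots> \<le> M + (\<Sum>d\<in>?D. M * (real d)\<^sup>2)"
  proof (intro add_mono sum_mono)
    fix d assume d: "d \<in> ?D"
    \<comment> \<open>Here \<open>r \<le> 1\<close> is essential: the recursion brings in smaller
      indices d, for which only the weight \<open>r ^ d\<close> is controlled.\<close>
    have "of_nat d * norm (?\<alpha> d) * r ^ n \<le> of_nat d * norm (?\<alpha> d) * r ^ d"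
      using d r by (intro mult_left_mono power_decreasing) auto
    also have "\<dots> \<le> M * (real d)\<^sup>2"
      using d D by (intro less.IH) auto
    finally show "of_nat d * norm (?\<alpha> d) * r ^ n \<le> M * (real d)\<^sup>2" .
  qed (use g less.prems in auto)
  also have "\<dots> = M + M * (\<Sum>d\<in>?D. (real d)\<^sup>2)"
    by (simp add: sum_distrib_left)
  also have "\<dots> \<le> M + M * ((real n)\<^sup>2 - 1)"
    using \<open>M \<ge> 0\<close> sum_proper_divisor_squares_le [OF less.prems]
    by (intro add_mono mult_left_mono) auto
  finally show ?case
    by (simp add: algebra_simps)
qed

lemma summable_exponent_of_log_deriv:
  assumes \<epsilon>: "\<And>n. 1 \<le> n \<Longrightarrow> \<epsilon> n \<in> {1, - 1}" and "R \<le> 1"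
    and g: "\<And>r. 0 < r \<Longrightarrow> r < R \<Longrightarrow> summable (\<lambda>n. norm (g n) * r ^ n)"
    and \<rho>: "0 < \<rho>" "\<rho> < R"
  shows "summable (\<lambda>n. norm (exponent_of_log_deriv \<epsilon> g n) * \<rho> ^ n)"
proof -
  \<comment> \<open>The gap between \<rho> and r yields a factor \<open>(\<rho> / r) ^ n\<close>
    that beats the polynomial growth.\<close>
  obtain r where r: "\<rho> < r" "r < R"
    using dense \<rho> by blast
  have "(\<lambda>n. norm (g n) * r ^ n) \<longlonglongrightarrow> 0"
    using r \<rho> by (intro summable_LIMSEQ_zero g) auto
  then have "Bseq (\<lambda>n. norm (g n) * r ^ n)"
    by (intro convergent_imp_Bseq convergentI)
  then obtain M where M: "norm (norm (g n) * r ^ n) \<le> M" for n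
    by (auto simp: Bseq_def)
  have M': "norm (g n) * r ^ n \<le> M" for n
    using M [of n] by simp
  let ?\<alpha> = "exponent_of_log_deriv \<epsilon> g"
  have "M \<ge> 0"
    using M [of 0] by (rule order_trans [OF norm_ge_zero])
  \<comment> \<open>\<open>Suc n\<close> in place of n matches the differentiated geometric series
    used as majorant.\<close>
  have "norm (norm (?\<alpha> n) * \<rho> ^ n) \<le> M * (of_nat (Suc n) * (\<rho> / r) ^ n)" if "1 \<le> n" for n
  proof -
    have "of_nat n * norm (?\<alpha> n) * r ^ n \<le> M * (real n)\<^sup>2"
      by (rule exponent_of_log_deriv_bound) (use \<epsilon> r \<rho> \<open>R \<le> 1\<close> M' that in auto)
    then have "norm (?\<alpha> n) * r ^ n \<le> M * real n"
      using that by (simp add: power2_eq_square mult_ac)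
    also have "\<dots> \<le> M * real (Suc n)"
      using \<open>M \<ge> 0\<close> by (intro mult_left_mono) auto
    finally have "norm (?\<alpha> n) * r ^ n * (\<rho> / r) ^ n \<le> M * real (Suc n) * (\<rho> / r) ^ n"
      using r \<rho> by (intro mult_right_mono) auto
    then show ?thesis
      using r \<rho> by (simp add: power_divide mult.assoc)
  qed
  moreover have "summable (\<lambda>n. M * (of_nat (Suc n) * (\<rho> / r) ^ n))"
    using r \<rho> by (intro summable_mult sums_summable [OF geometric_deriv_sums]) auto
  ultimately show ?thesis
    by (rule summable_comparison_test' [rotated])
qed

subsection \<open>Existence of the expansion\<close>

lemma compact_subset_ball_obtain_cball:
  fixes K :: "'a :: real_normed_vector set"
  assumes "compact K" "K \<subseteq> ball 0 R" "0 < R"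
  obtains \<rho> where "0 < \<rho>" "\<rho> < R" "K \<subseteq> cball 0 \<rho>"
proof (cases "K = {}")
  case True
  then show ?thesis
    using that [of "R / 2"] \<open>0 < R\<close> by auto
next
  case False
  then obtain x where x: "x \<in> K" "\<And>y. y \<in> K \<Longrightarrow> norm y \<le> norm x"
    using continuous_attains_sup [of K norm] \<open>compact K\<close> by (auto intro: continuous_intros)
  then have "norm x < R"
    using assms by auto
  \<comment> \<open>The maximum with \<open>R / 2\<close> keeps the radius positive even for
    \<open>K = {0}\<close>.\<close>
  moreover have "K \<subseteq> cball 0 (max (norm x) (R / 2))"
    using x by (auto simp: le_max_iff_disj)
  ultimately show ?thesis
    using that [of "max (norm x) (R / 2)"] \<open>0 < R\<close> by auto
qed

text \<open>Since \<open>exp\<close> is not uniformly continuous on the whole plane, all values are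
  first confined to a compact disk: g is bounded on K by some B, and \<open>f n\<close> is
  eventually within 1 of g.\<close>

lemma uniform_limit_exp:
  fixes f :: "'a \<Rightarrow> 'b :: topological_space \<Rightarrow> complex"
  assumes lim: "uniform_limit K f g F" and "compact K" "continuous_on K g"
  shows "uniform_limit K (\<lambda>n z. exp (f n z)) (\<lambda>z. exp (g z)) F"
proof -
  have "bounded (g ` K)"
    using assms by (intro compact_imp_bounded compact_continuous_image)
  then obtain B where B: "\<And>z. z \<in> K \<Longrightarrow> norm (g z) \<le> B"
    by (auto simp: bounded_iff)
  show ?thesis
  proof (rule uniform_limit_compose_uniformly_continuous_on [OF lim, where B = "cball 0 (B + 1)"])
    show "uniformly_continuous_on (cball 0 (B + 1)) (exp :: complex \<Rightarrow> _)"
      by (intro compact_uniformly_continuous continuous_intros) auto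
    from lim have "\<forall>\<^sub>F n in F. \<forall>z\<in>K. dist (f n z) (g z) < 1"
      by (rule uniform_limitD) simp
    then show "\<forall>\<^sub>F n in F. \<forall>z\<in>K. f n z \<in> cball 0 (B + 1)"
    proof eventually_elim
      case (elim n)
      have "norm (f n z) \<le> B + 1" if "z \<in> K" for z
        using norm_triangle_ineq2 [of "f n z" "g z"] B [OF that] elim that by (force simp: dist_norm)
      then show ?case by simp
    qed
  qed auto
qed

lemma power_product_converges_to_exp:
  assumes "0 < R" "R \<le> 1" and \<epsilon>: "\<And>n. 1 \<le> n \<Longrightarrow> \<epsilon> n \<in> {1, - 1}"
    and \<alpha>: "\<And>\<rho>. 0 < \<rho> \<Longrightarrow> \<rho> < R \<Longrightarrow> summable (\<lambda>n. norm (\<alpha> n) * \<rho> ^ n)"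
  obtains L where "L holomorphic_on ball 0 R"
    "\<And>K. compact K \<Longrightarrow> K \<subseteq> ball 0 R \<Longrightarrow>
       uniform_limit K (partial_power_product \<epsilon> \<alpha>) (\<lambda>z. exp (L z)) sequentially"
proof
  \<comment> \<open>The shift to \<open>Suc n\<close> makes the sum over \<open>n < N\<close> run
    through the factors 1 to N.\<close>
  define a where "a = (\<lambda>n z. \<alpha> (Suc n) * Ln (1 + \<epsilon> (Suc n) * z ^ Suc n))"
  define L where "L = (\<lambda>z. \<Sum>n. a n z)"
  have base: "1 + \<epsilon> (Suc n) * z ^ Suc n \<notin> \<real>\<^sub>\<le>\<^sub>0" if "z \<in> ball 0 R" for n z
    by (rule one_plus_sign_power_not_nonpos) (use that \<open>R \<le> 1\<close> \<epsilon> in auto)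
  have lim: "uniform_limit (cball 0 \<rho>) (\<lambda>N z. \<Sum>n<N. a n z) L sequentially" if "0 < \<rho>" "\<rho> < R" for \<rho>
    unfolding L_def
  proof (rule Weierstrass_m_test_ev)
    \<comment> \<open>The estimate \<open>norm (Ln (1 + w)) \<le> 2 * norm w\<close> needs
      \<open>norm w < 1 / 2\<close>, which holds only for large n; hence the eventual form of the
      M-test.\<close>
    have "(\<lambda>n. \<rho> ^ Suc n) \<longlonglongrightarrow> 0"
      using that \<open>R \<le> 1\<close> by (intro LIMSEQ_Suc LIMSEQ_power_zero) auto
    then have "\<forall>\<^sub>F n in sequentially. \<rho> ^ Suc n < 1 / 2"
      by (rule order_tendstoD) simp
    then show "\<forall>\<^sub>F n in sequentially. \<forall>z\<in>cball 0 \<rho>. norm (a n z) \<le> 2 * (norm (\<alpha> (Suc n)) * \<rho> ^ Suc n)"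
    proof eventually_elim
      case (elim n)
      show ?case
      proof
        fix z :: complex assume z: "z \<in> cball 0 \<rho>"
        let ?w = "\<epsilon> (Suc n) * z ^ Suc n"
        have "norm (\<epsilon> (Suc n)) = 1"
          using \<epsilon> [of "Suc n"] by auto
        then have "norm ?w = norm z ^ Suc n"
          by (simp only: norm_mult norm_power mult_1)
        also have "\<dots> \<le> \<rho> ^ Suc n"
          using z by (intro power_mono) auto
        finally have w: "norm ?w \<le> \<rho> ^ Suc n" .
        then have "norm (Ln (1 + ?w)) \<le> 2 * norm ?w"
          using elim by (intro norm_Ln_le) linarith
        with w have "norm (Ln (1 + ?w)) \<le> 2 * \<rho> ^ Suc n"
          by linarith
        then have "norm (\<alpha> (Suc n)) * norm (Ln (1 + ?w)) \<le> norm (\<alpha> (Suc n)) * (2 * \<rho> ^ Suc n)"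
          by (intro mult_left_mono) auto
        then show "norm (a n z) \<le> 2 * (norm (\<alpha> (Suc n)) * \<rho> ^ Suc n)"
          unfolding a_def norm_mult by (simp only: mult_ac)
      qed
    qed
    show "summable (\<lambda>n. 2 * (norm (\<alpha> (Suc n)) * \<rho> ^ Suc n))"
      using \<alpha> [OF that] summable_Suc_iff [of "\<lambda>n. norm (\<alpha> n) * \<rho> ^ n"]
      by (intro summable_mult) simp
  qed
  have holo_sum: "(\<lambda>z. \<Sum>n<N. a n z) holomorphic_on ball 0 R" for N
    unfolding a_def by (intro holomorphic_intros base)
  show holo: "L holomorphic_on ball 0 R"
  proof (rule holomorphic_uniform_sequence [OF _ holo_sum])
    fix x :: complex assume x: "x \<in> ball 0 R"
    then obtain d where d: "0 < d" "cball x d \<subseteq> ball 0 R"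
      by (metis open_ball open_contains_cball)
    moreover obtain \<rho> where "0 < \<rho>" "\<rho> < R" "cball x d \<subseteq> cball 0 \<rho>"
      using compact_subset_ball_obtain_cball [OF compact_cball d(2) \<open>0 < R\<close>] .
    ultimately show "\<exists>d>0. cball x d \<subseteq> ball 0 R \<and>
        uniform_limit (cball x d) (\<lambda>N z. \<Sum>n<N. a n z) L sequentially"
      using uniform_limit_on_subset [OF lim] by blast
  qed auto
  fix K :: "complex set"
  assume K: "compact K" "K \<subseteq> ball 0 R"
  then obtain \<rho> where "0 < \<rho>" "\<rho> < R" "K \<subseteq> cball 0 \<rho>"
    using compact_subset_ball_obtain_cball \<open>0 < R\<close> by metis
  then have "uniform_limit K (\<lambda>N z. \<Sum>n<N. a n z) L sequentially"
    using uniform_limit_on_subset [OF lim] by blast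
  then have "uniform_limit K (\<lambda>N z. exp (\<Sum>n<N. a n z)) (\<lambda>z. exp (L z)) sequentially"
    using K holo by (intro uniform_limit_exp) (auto intro: holomorphic_on_imp_continuous_on holomorphic_on_subset)
  moreover have "exp (\<Sum>n<N. a n z) = partial_power_product \<epsilon> \<alpha> N z" if "z \<in> K" for N z
  proof -
    \<comment> \<open>\<open>powr\<close> is \<open>exp\<close> of a multiple of \<open>Ln\<close>
      only for a nonzero base.\<close>
    have "1 + \<epsilon> (Suc n) * z ^ Suc n \<noteq> 0" for n
      using base [of z n] that K(2) by (metis nonpos_Reals_zero_I subsetD)
    then show ?thesis
      by (simp add: partial_power_product_def prod.atLeast1_atMost_eq exp_sum a_def powr_def del: power_Suc)
  qed
  ultimately show "uniform_limit K (partial_power_product \<epsilon> \<alpha>) (\<lambda>z. exp (L z)) sequentially"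
    by (subst (asm) uniform_limit_cong') auto
qed

text \<open>The quotient \<open>f / h\<close> has derivative 0 on a convex set, hence is
  constant.\<close>

lemma equal_log_deriv_imp_proportional:
  assumes "f holomorphic_on ball 0 R" "h holomorphic_on ball 0 R"
    and h: "\<And>z. z \<in> ball 0 R \<Longrightarrow> h z \<noteq> 0" and f: "\<And>z. z \<in> ball 0 R \<Longrightarrow> f z \<noteq> 0"
    and eq: "\<And>z. z \<in> ball 0 R \<Longrightarrow> deriv f z / f z = deriv h z / h z"
    and z: "z \<in> ball 0 R"
  shows "f z * h 0 = f 0 * h z"
proof -
  have "\<exists>c. \<forall>z\<in>ball 0 R. f z / h z = c"
  proof (rule has_field_derivative_zero_constant)
    fix w :: complex assume w: "w \<in> ball 0 R"
    have "(f has_field_derivative deriv f w) (at w)" "(h has_field_derivative deriv h w) (at w)"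
      using assms(1,2) w by (auto intro: holomorphic_derivI)
    then have "((\<lambda>z. f z / h z) has_field_derivative
        (deriv f w * h w - f w * deriv h w) / (h w * h w)) (at w)"
      by (rule DERIV_divide) (use h w in auto)
    moreover have "deriv f w * h w - f w * deriv h w = 0"
      using eq [OF w] f [OF w] h [OF w] by (simp add: frac_eq_eq mult_ac)
    ultimately show "((\<lambda>z. f z / h z) has_field_derivative 0) (at w within ball 0 R)"
      by (simp add: has_field_derivative_at_within)
  qed auto
  moreover have "0 \<in> ball 0 R"
    using z by (auto intro: le_less_trans [OF norm_ge_zero])
  ultimately have "f z / h z = f 0 / h 0" and "h 0 \<noteq> 0"
    using z h by auto
  then show ?thesis
    using h [OF z] by (simp add: field_simps)
qed

lemma power_product_expansion_exists:
  assumes R: "0 < R" "R \<le> 1" and f: "f holomorphic_on ball 0 R"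
    and nz: "\<And>z. z \<in> ball 0 R \<Longrightarrow> f z \<noteq> 0"
    and \<epsilon>: "\<And>n. 1 \<le> n \<Longrightarrow> \<epsilon> n \<in> {1, - 1}"
  shows "\<exists>\<alpha>. power_product_converges_compactly R f \<epsilon> \<alpha>"
proof -
  have "(\<lambda>z. deriv f z / f z) holomorphic_on ball 0 R"
    using f nz by (intro holomorphic_intros) auto
  moreover from this have G: "(\<lambda>z. deriv f z / f z) has_fps_expansion fps_expansion (\<lambda>z. deriv f z / f z) 0"
    by (intro has_fps_expansion_fps_expansion) (use R in auto)
  moreover define G where "G = fps_expansion (\<lambda>z. deriv f z / f z) 0"
  ultimately have radius: "fps_conv_radius G \<ge> ereal R"
    by (intro holomorphic_on_imp_fps_conv_radius_ge [of "\<lambda>z. deriv f z / f z"]) auto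
  \<comment> \<open>In the theorem \<open>g n\<close> belongs to \<open>z ^ (n - 1)\<close>, hence
    the index shift.\<close>
  define \<alpha> where "\<alpha> = exponent_of_log_deriv \<epsilon> (\<lambda>n. fps_nth G (n - 1))"
  have summable_\<alpha>: "summable (\<lambda>n. norm (\<alpha> n) * \<rho> ^ n)" if "0 < \<rho>" "\<rho> < R" for \<rho>
    unfolding \<alpha>_def
  proof (rule summable_exponent_of_log_deriv [OF \<epsilon> \<open>R \<le> 1\<close> _ that])
    fix r :: real assume r: "0 < r" "r < R"
    then have "ereal (norm (complex_of_real r)) < fps_conv_radius G"
      using radius by (intro less_le_trans [OF _ radius]) auto
    then have "summable (\<lambda>n. norm (fps_nth G n * of_real r ^ n))"
      by (intro abs_summable_in_conv_radius) (simp add: fps_conv_radius_def)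
    then have "summable (\<lambda>n. r * (norm (fps_nth G n) * r ^ n))"
      using r by (intro summable_mult) (simp add: norm_mult norm_power)
    then show "summable (\<lambda>n. norm (fps_nth G (n - 1)) * r ^ n)"
      by (subst summable_Suc_iff [symmetric]) (simp add: mult_ac)
  qed
  obtain L where L: "L holomorphic_on ball 0 R"
    and lim: "\<And>K. compact K \<Longrightarrow> K \<subseteq> ball 0 R \<Longrightarrow>
       uniform_limit K (partial_power_product \<epsilon> \<alpha>) (\<lambda>z. exp (L z)) sequentially"
    using power_product_converges_to_exp [where \<epsilon> = \<epsilon> and \<alpha> = \<alpha>, OF R \<epsilon> summable_\<alpha>] by metis
  define h where "h = (\<lambda>z. exp (L z))"
  have h: "h holomorphic_on ball 0 R"
    using L unfolding h_def by (intro holomorphic_intros)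
  have "(\<lambda>N. partial_power_product \<epsilon> \<alpha> N 0) \<longlonglongrightarrow> h 0"
    using lim [of "{0}"] R by (simp add: h_def)
  moreover have "partial_power_product \<epsilon> \<alpha> N 0 = 1" for N
    by (auto simp: partial_power_product_def power_0_left intro!: prod.neutral)
  ultimately have h0: "h 0 = 1"
    by (simp add: LIMSEQ_const_iff)
  \<comment> \<open>As \<open>h 0 = 1\<close>, h is the compact limit of its own power product, so
    its logarithmic derivative has the divisor sums of \<alpha> as coefficients; by the choice of
    \<alpha> these are the coefficients of G.\<close>
  have conv_h: "power_product_converges_compactly R h \<epsilon> \<alpha>"
    unfolding power_product_converges_compactly_def using lim h0 by (auto simp: h_def)
  have "h has_fps_expansion fps_expansion h 0"
    by (rule has_fps_expansion_fps_expansion [OF _ _ h]) (use R in auto)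
  from log_deriv_of_convergent_power_product [OF R \<epsilon> conv_h this]
  have "(\<lambda>z. deriv h z / h z) has_fps_expansion
     Abs_fps (\<lambda>m. - (\<Sum>d | d dvd Suc m. of_nat d * \<alpha> d * (- \<epsilon> d) ^ (Suc m div d)))"
    by (simp add: h0)
  also have "Abs_fps (\<lambda>m. - (\<Sum>d | d dvd Suc m. of_nat d * \<alpha> d * (- \<epsilon> d) ^ (Suc m div d))) = G"
    unfolding \<alpha>_def
    by (rule fps_ext) (subst fps_nth_Abs_fps, subst exponent_of_log_deriv_divisor_sum, use \<epsilon> in auto)
  finally have H: "(\<lambda>z. deriv h z / h z) has_fps_expansion G" .
  have h_nz: "h z \<noteq> 0" for z
    by (simp add: h_def)
  have "deriv f z / f z = deriv h z / h z" if "z \<in> ball 0 R" for z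
  proof -
    \<comment> \<open>Both logarithmic derivatives are holomorphic on the disk, so their common
      Taylor series represents them on all of it, not just near 0.\<close>
    have "eval_fps G z = deriv f z / f z"
      using G that f nz unfolding G_def
      by (intro has_fps_expansion_imp_eval_fps_eq [where r = R] holomorphic_intros) auto
    moreover have "eval_fps G z = deriv h z / h z"
      using H that h h_nz
      by (intro has_fps_expansion_imp_eval_fps_eq [where r = R] holomorphic_intros) auto
    ultimately show ?thesis
      by simp
  qed
  then have f_eq: "f 0 * h z = f z" if "z \<in> ball 0 R" for z
    using equal_log_deriv_imp_proportional [OF f h h_nz nz _ that] h0 by simp
  have "power_product_converges_compactly R f \<epsilon> \<alpha>"
    unfolding power_product_converges_compactly_def
  proof (intro allI impI)
    fix K :: "complex set" assume K: "compact K \<and> K \<subseteq> ball 0 R"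
    then have "uniform_limit K (\<lambda>N z. f 0 * partial_power_product \<epsilon> \<alpha> N z) (\<lambda>z. f 0 * h z) sequentially"
      unfolding h_def by (intro bounded_linear.uniform_limit [OF bounded_linear_mult_right] lim) auto
    then show "uniform_limit K (\<lambda>N z. f 0 * partial_power_product \<epsilon> \<alpha> N z) f sequentially"
      by (rule uniform_limit_cong' [THEN iffD1, rotated -1]) (use K f_eq in auto)
  qed
  then show ?thesis by blast
qed

section \<open>Uniqueness and the coefficient identities\<close>

theorem theorem2p9:
  fixes R :: real and f :: "complex \<Rightarrow> complex" and \<epsilon> :: "nat \<Rightarrow> complex"
  assumes "0 < R" and "R \<le> 1"
    and "f analytic_on ball 0 R"
    and "\<And>z. z \<in> ball 0 R \<Longrightarrow> f z \<noteq> 0"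
    and "\<And>n. n \<ge> 1 \<Longrightarrow> \<epsilon> n \<in> {1, - 1}"
  shows "\<exists>\<alpha> :: nat \<Rightarrow> complex.
      power_product_converges_compactly R f \<epsilon> \<alpha> \<and>
      (\<forall>\<beta>. power_product_converges_compactly R f \<epsilon> \<beta> \<longrightarrow> (\<forall>n\<ge>1. \<beta> n = \<alpha> n)) \<and>
      (\<forall>b g :: nat \<Rightarrow> complex.
        (\<forall>z\<in>ball 0 R. \<exists>S. (\<lambda>n. b (Suc n) * z ^ Suc n) sums S \<and> f z = f 0 * (1 + S)) \<longrightarrow>
        (\<forall>z\<in>ball 0 R. (\<lambda>n. g (Suc n) * z ^ n) sums (deriv f z / f z)) \<longrightarrow>
        (\<forall>n\<ge>1.
          b n = (\<Sum>k\<in>weighted_exponents n.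
                   (\<Prod>i = 1..n. \<alpha> i gchoose k i) * (\<Prod>i = 1..n. \<epsilon> i ^ k i)) \<and>
          of_nat n * b n = g n + (\<Sum>k = 1..<n. b k * g (n - k)) \<and>
          - g n = (\<Sum>d | d dvd n. of_nat d * \<alpha> d * (- \<epsilon> d) ^ (n div d))))"
proof -
  have f: "f holomorphic_on ball 0 R"
    using assms(3) by (rule analytic_imp_holomorphic)
  obtain \<alpha> where \<alpha>: "power_product_converges_compactly R f \<epsilon> \<alpha>"
    using power_product_expansion_exists [where \<epsilon> = \<epsilon>] assms(1,2) f assms(4,5) by blast
  define F where "F = fps_expansion f 0"
  have F: "f has_fps_expansion F"
    unfolding F_def by (rule has_fps_expansion_fps_expansion [OF _ _ f]) (use assms(1) in auto)
  have f0: "f 0 \<noteq> 0"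
    using assms(1,4) by simp
  have F_eq: "F = fps_const (f 0) * product_fps \<epsilon> \<beta>"
    if "power_product_converges_compactly R f \<epsilon> \<beta>" for \<beta>
    using assms(1,2,5) that F by (rule fps_expansion_of_convergent_power_product)
  have nhds_ball: "\<forall>\<^sub>F z in nhds 0. z \<in> ball (0 :: complex) R"
    using assms(1) by (intro eventually_nhds_in_open) auto
  show ?thesis
  proof (intro exI [of _ \<alpha>] conjI allI impI)
    fix \<beta> and n :: nat assume \<beta>: "power_product_converges_compactly R f \<epsilon> \<beta>" and "1 \<le> n"
    have "product_fps \<epsilon> \<beta> = product_fps \<epsilon> \<alpha>"
      using F_eq [OF \<alpha>] F_eq [OF \<beta>] f0 by simp
    then show "\<beta> n = \<alpha> n"
    proof (rule product_fps_inject)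
      show "\<epsilon> n \<noteq> 0" if "1 \<le> n" for n
        using assms(5) [OF that] by auto
    qed fact
  next
    fix b g :: "nat \<Rightarrow> complex" and n :: nat
    assume b: "\<forall>z\<in>ball 0 R. \<exists>S. (\<lambda>n. b (Suc n) * z ^ Suc n) sums S \<and> f z = f 0 * (1 + S)"
      and g: "\<forall>z\<in>ball 0 R. (\<lambda>n. g (Suc n) * z ^ n) sums (deriv f z / f z)"
      and n: "1 \<le> n"
    \<comment> \<open>The Taylor series of \<open>f z / f 0\<close>. Its constant term is set to 1
      explicitly, since the value \<open>b 0\<close> is arbitrary.\<close>
    define B where "B = Abs_fps (\<lambda>n. if n = 0 then 1 else b n)"
    have "(\<lambda>z. f z / f 0) has_fps_expansion B"
    proof (rule has_fps_expansionI, use nhds_ball in eventually_elim)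
      case (elim z)
      then obtain S where S: "(\<lambda>n. b (Suc n) * z ^ Suc n) sums S" "f z = f 0 * (1 + S)"
        using b by blast
      have "(\<lambda>n. fps_nth B (Suc n) * z ^ Suc n) sums (f z / f 0 - fps_nth B 0 * z ^ 0)"
        using S f0 by (simp add: B_def)
      then show "(\<lambda>n. fps_nth B n * z ^ n) sums (f z / f 0)"
        by (subst (asm) sums_Suc_iff) simp
    qed
    from has_fps_expansion_cmult_left [OF this, of "f 0"]
    have "f has_fps_expansion fps_const (f 0) * B"
      using f0 by simp
    with F have "fps_const (f 0) * B = fps_const (f 0) * product_fps \<epsilon> \<alpha>"
      unfolding F_eq [OF \<alpha>] by (rule fps_expansion_unique_complex [symmetric])
    then have B: "B = product_fps \<epsilon> \<alpha>"
      using f0 by simp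
    have "(\<lambda>z. deriv f z / f z) has_fps_expansion Abs_fps (\<lambda>n. g (Suc n))"
      using nhds_ball g by (intro has_fps_expansionI) (auto elim: eventually_mono)
    moreover have "(\<lambda>z. deriv f z / f z) has_fps_expansion
        Abs_fps (\<lambda>m. - (\<Sum>d | d dvd Suc m. of_nat d * \<alpha> d * (- \<epsilon> d) ^ (Suc m div d)))"
      using assms(1,2,5) \<alpha> F f0 by (rule log_deriv_of_convergent_power_product)
    ultimately have G: "Abs_fps (\<lambda>n. g (Suc n)) =
        Abs_fps (\<lambda>m. - (\<Sum>d | d dvd Suc m. of_nat d * \<alpha> d * (- \<epsilon> d) ^ (Suc m div d)))"
      by (rule fps_expansion_unique_complex)
    obtain m where m: "n = Suc m"
      using n by (cases n) auto
    show "- g n = (\<Sum>d | d dvd n. of_nat d * \<alpha> d * (- \<epsilon> d) ^ (n div d))"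
      using arg_cong [OF G, of "\<lambda>G. fps_nth G m"] by (simp add: m)
    have "b n = fps_nth B n"
      using n by (simp add: B_def)
    then show "b n = (\<Sum>k\<in>weighted_exponents n.
                   (\<Prod>i = 1..n. \<alpha> i gchoose k i) * (\<Prod>i = 1..n. \<epsilon> i ^ k i))"
      unfolding B by (simp only: product_fps_nth)
    \<comment> \<open>The recursion for \<open>b n\<close> is coefficient \<open>m = n - 1\<close>
      of this identity; the summand \<open>k = 0\<close> yields the isolated
      \<open>g n\<close>.\<close>
    have "fps_deriv B = B * Abs_fps (\<lambda>n. g (Suc n))"
      unfolding B G by (rule fps_deriv_product_fps)
    then have "fps_nth (fps_deriv B) m = (\<Sum>k = 0..m. fps_nth B k * g (Suc (m - k)))"
      by (simp add: fps_mult_nth)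
    also have "\<dots> = g n + (\<Sum>k = 1..m. fps_nth B k * g (Suc (m - k)))"
      by (simp add: sum.atLeast_Suc_atMost B_def m)
    also have "(\<Sum>k = 1..m. fps_nth B k * g (Suc (m - k))) = (\<Sum>k = 1..<n. b k * g (n - k))"
      by (intro sum.cong) (auto simp: m B_def Suc_diff_le)
    finally show "of_nat n * b n = g n + (\<Sum>k = 1..<n. b k * g (n - k))"
      by (simp add: m B_def)
  qed (rule \<alpha>)
qed

end
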